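(* There exists a planar graph $G_{52}$ on $52$ vertices with $a(G_{52})=25$. Hence, $c_{\mathcal P}\leq \frac{25}{52}$.
   Context: All graphs are finite, simple and non-empty. For a graph $G$, $a(G)$ denotes the maximum of $|F|$ over all $F\subseteq V(G)$ such that the induced subgraph $G[F]$ is a forest (acyclic). The constant $c_{\mathcal P}$ is defined by $c_{\mathcal P}:=\inf\left\{\frac{a(G)}{|V(G)|}: G \text{ is a planar graph}\right\}$. *)

theory Defs
  imports "HOL-Analysis.Analysis" "Graph_Theory.Digraph_Component"
begin

text \<open>
  A finite simple graph is a \<^locale>\<open>pair_graph\<close>: a finite loopless digraph without parallel arcs
  in which the arcs \<open>(u, v)\<close> and \<open>(v, u)\<close> occur together and stand for the undirected edge
  \<open>{u, v}\<close>.
\<close>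

definition edges :: "'a pair_pre_digraph \<Rightarrow> 'a set set" where
  "edges G = {{u, v} | u v. (u, v) \<in> parcs G}"

text \<open>
  The constant \<^const>\<open>forest\<close> of the library excludes directed cycles of every length, in
  particular the closed walk \<open>(u, v), (v, u)\<close> that every edge of a symmetric digraph provides. For
  the underlying undirected graph only cycles of length at least three count.
\<close>

definition undirected_forest :: "('a, 'b) pre_digraph \<Rightarrow> bool" where
  "undirected_forest H \<longleftrightarrow> \<not> (\<exists>p. pre_digraph.cycle H p \<and> 3 \<le> length p)"

definition forest_number :: "'a pair_pre_digraph \<Rightarrow> nat" where
  "forest_number G =
     Max {card F | F. F \<subseteq> pverts G \<and> undirected_forest (with_proj G \<restriction> F)}"

text \<open>
  A drawing in the plane, which is identified with the complex numbers: vertices are distinct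
  points, the edge \<open>{u, v}\<close> is a simple curve joining the points of \<open>u\<close> and \<open>v\<close>, no curve passes
  through the point of any other vertex, and two distinct edges meet only in the points of their
  common end vertices.
\<close>

definition plane_drawing ::
  "'a pair_pre_digraph \<Rightarrow> ('a \<Rightarrow> complex) \<Rightarrow> ('a set \<Rightarrow> real \<Rightarrow> complex) \<Rightarrow> bool" where
  "plane_drawing G pos crv \<longleftrightarrow>
     inj_on pos (pverts G) \<and>
     (\<forall>e \<in> edges G. arc (crv e) \<and> {pathstart (crv e), pathfinish (crv e)} = pos ` e) \<and>
     (\<forall>e \<in> edges G. \<forall>w \<in> pverts G. pos w \<in> path_image (crv e) \<longrightarrow> w \<in> e) \<and>
     (\<forall>e \<in> edges G. \<forall>e' \<in> edges G. e \<noteq> e' \<longrightarrow>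
        path_image (crv e) \<inter> path_image (crv e') \<subseteq> pos ` (e \<inter> e'))"

definition planar_graph :: "'a pair_pre_digraph \<Rightarrow> bool" where
  "planar_graph G \<longleftrightarrow>
     pair_graph G \<and> pverts G \<noteq> {} \<and> (\<exists>pos crv. plane_drawing G pos crv)"

text \<open>
  Every finite graph is isomorphic to one whose vertices are natural numbers, so the infimum over
  graphs on \<^typ>\<open>nat\<close> is the infimum over all planar graphs.
\<close>

definition c_planar :: real where
  "c_planar = Inf {real (forest_number G) / real (card (pverts G)) | G :: nat pair_pre_digraph.
     planar_graph G}"

end

theory Submission
  imports Defs
begin

text \<open>
  The graph is built from a \<^emph>\<open>gadget\<close>: a triangulated disc with boundary triangle \<open>0, 1, 2\<close> and
  \<open>16\<close> inner vertices. An induced forest contains at most \<open>8\<close> of the inner vertices, half of them, and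
  at most \<open>7\<close> as soon as it contains both ends of the boundary edge \<open>02\<close> or of the boundary edge
  \<open>12\<close> (lemma \<open>gadget_bound\<close>). So the gadget charges one vertex to a forest that uses one of these two
  edges. The tetrahedron has six edges, and three copies of the gadget, placed in three of its faces,
  charge each of them exactly once. If \<open>F\<close> is an induced forest of the resulting graph on
  \<open>4 + 3 * 16 = 52\<close> vertices and \<open>S\<close> is the set of its tetrahedron vertices, then \<open>F\<close> has at most
  \<open>24\<close> inner vertices minus the number of copies that charge. A single vertex of \<open>S\<close> is charged
  nothing, two are an edge and are charged by one copy, three are charged by at least two copies and
  four by all three copies. Hence \<open>F\<close> has at most \<open>25\<close> vertices, one less than half of all.

  The gadget bound is a finite statement about \<open>16\<close> inner vertices. Its proof only uses that the
  complement of a forest meets every cycle: \<open>m\<close> pairwise disjoint cycles force \<open>m\<close> missing vertices, and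
  where no sufficiently large packing exists one distinguishes whether some vertex belongs to the
  forest. Three trees of such case distinctions, with fewer than a hundred packings each, prove the
  three cases of the bound; lemma \<open>forces_sound\<close> justifies the trees.

  Planarity follows from Schnyder's method. Three coordinates with constant sum are assigned to every
  vertex such that, for each edge and each vertex off the edge, some coordinate is larger at the vertex
  than at both ends of the edge. Two disjoint edges are then separated by a level line of one of the
  coordinates, and the straight-line drawing in the plane of the coordinates has no crossings (lemma
  \<open>plane_drawing_straight\<close>).
\<close>

section \<open>Cycles and induced forests\<close>

text \<open>
  The walk predicates of an induced subgraph only refer to the end points of arcs, which do not depend
  on the vertex set, so they reduce to statements about lists of pairs.
\<close>

lemma cas_induce_map:
  "pre_digraph.cas (with_proj G \<restriction> F) u p v \<Longrightarrow> map fst p @ [v] = u # map snd p"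
  by (induction p arbitrary: u) (auto simp: pre_digraph.cas.simps)

lemma cas_induce_zip:
  "pre_digraph.cas (with_proj G \<restriction> F) u (zip (u # ws) (ws @ [v])) v"
  by (induction ws arbitrary: u) (auto simp: pre_digraph.cas.simps)

lemma not_forest_if_cyclic_list:
  assumes vs: "distinct vs" "3 \<le> length vs" "set vs \<subseteq> F" "F \<subseteq> pverts G"
    and adj: "\<forall>e \<in> set (zip vs (rotate1 vs)). e \<in> parcs G"
  shows "\<not> undirected_forest (with_proj G \<restriction> F)"
proof -
  obtain u ws where uw: "vs = u # ws"
    using vs(2) by (cases vs) auto
  let ?H = "with_proj G \<restriction> F" and ?p = "zip (u # ws) (ws @ [u])"
  have cas: "pre_digraph.cas ?H u ?p u"
    by (rule cas_induce_zip)
  have "set ?p \<subseteq> arcs ?H"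
  proof
    fix e assume e: "e \<in> set ?p"
    then have "e \<in> parcs G"
      using adj uw by simp
    moreover have "fst e \<in> set (u # ws)" "snd e \<in> set (ws @ [u])"
      using set_zip_leftD[of "fst e" "snd e"] set_zip_rightD[of "fst e" "snd e"] e
      unfolding prod.collapse by blast+
    ultimately show "e \<in> arcs ?H"
      using vs(3) uw by auto
  qed
  with cas have "pre_digraph.awalk ?H u ?p u"
    using vs(3,4) uw unfolding pre_digraph.awalk_def by auto
  moreover have "tl (pre_digraph.awalk_verts ?H u ?p) = ws @ [u]"
    by (subst pre_digraph.awalk_verts_conv'[OF cas]) (simp add: map_snd_zip del: zip_Cons_Cons)
  ultimately have "pre_digraph.cycle ?H ?p"
    using vs(1) uw unfolding pre_digraph.cycle_def by (intro exI[of _ u]) auto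
  moreover have "3 \<le> length ?p"
    using vs(2) uw by simp
  ultimately show ?thesis
    unfolding undirected_forest_def by blast
qed

text \<open>
  This is where the length bound matters: on the closed walk \<open>(u, v), (v, u)\<close> the predecessor and the
  successor of a vertex coincide.
\<close>

lemma cycle_vertex_two_neighbours:
  assumes cyc: "pre_digraph.cycle (with_proj G \<restriction> F) p" and len: "3 \<le> length p"
    and w: "w \<in> snd ` set p"
  shows "\<exists>x \<in> snd ` set p. \<exists>y \<in> snd ` set p. x \<noteq> y \<and> (x, w) \<in> parcs G \<and> (w, y) \<in> parcs G"
proof -
  let ?H = "with_proj G \<restriction> F" and ?n = "length p"
  obtain u where walk: "pre_digraph.awalk ?H u p u"
    and dist: "distinct (tl (pre_digraph.awalk_verts ?H u p))"
    using cyc by (auto simp: pre_digraph.cycle_def)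
  then have cas: "pre_digraph.cas ?H u p u" and arcs: "set p \<subseteq> parcs G"
    by (auto simp: pre_digraph.awalk_def)
  have ne: "p \<noteq> []"
    using len by auto
  have dist: "distinct (map snd p)"
    using dist ne by (simp add: pre_digraph.awalk_verts_conv'[OF cas])
  have link: "map fst p @ [u] = u # map snd p"
    by (rule cas_induce_map[OF cas])
  have step: "fst (p ! Suc i) = snd (p ! i)" if "Suc i < ?n" for i
    using arg_cong[OF link, of "\<lambda>l. l ! Suc i"] that by (simp add: nth_append)
  have wrap: "fst (p ! 0) = snd (p ! (?n - 1))"
  proof -
    have "fst (p ! 0) = u"
      using arg_cong[OF link, of hd] ne by (simp add: hd_append hd_conv_nth)
    moreover have "snd (last p) = u"
      using arg_cong[OF link, of last] ne by (simp add: last_map)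
    ultimately show ?thesis
      using ne by (simp add: last_conv_nth)
  qed
  obtain i where i: "i < ?n" "w = snd (p ! i)"
    using w by (auto simp: in_set_conv_nth)
  \<comment> \<open>The neighbours of \<open>w\<close>, the head of arc \<open>i\<close>, are the heads of the preceding arc \<open>j\<close> and of
    the following arc \<open>k\<close>.\<close>
  define j where "j = (if i = 0 then ?n - 1 else i - 1)"
  define k where "k = (if Suc i = ?n then 0 else Suc i)"
  have jk: "j < ?n" "k < ?n" "j \<noteq> k"
    using i len by (auto simp: j_def k_def)
  have "fst (p ! i) = snd (p ! j)"
  proof (cases "i = 0")
    case True
    then show ?thesis using wrap by (simp add: j_def)
  next
    case False
    then show ?thesis using step[of "i - 1"] i(1) by (simp add: j_def)
  qed
  moreover have "(fst (p ! i), snd (p ! i)) \<in> parcs G"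
    using subsetD[OF arcs nth_mem[OF i(1)]] by simp
  ultimately have pred: "(snd (p ! j), w) \<in> parcs G"
    using i(2) by simp
  have "fst (p ! k) = snd (p ! i)"
  proof (cases "Suc i = ?n")
    case True
    then have "?n - 1 = i" by simp
    then show ?thesis using wrap True by (simp add: k_def)
  next
    case False
    then show ?thesis using step[of i] i(1) by (simp add: k_def)
  qed
  moreover have "(fst (p ! k), snd (p ! k)) \<in> parcs G"
    using subsetD[OF arcs nth_mem[OF jk(2)]] by simp
  ultimately have succ: "(w, snd (p ! k)) \<in> parcs G"
    using i(2) by simp
  have "snd (p ! j) \<noteq> snd (p ! k)"
    using nth_eq_iff_index_eq[OF dist, of j k] jk by simp
  moreover have "snd (p ! j) \<in> snd ` set p" "snd (p ! k) \<in> snd ` set p"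
    using jk by auto
  ultimately show ?thesis
    using pred succ by blast
qed

text \<open>
  The vertices can be deleted from the front of the list so that each of them is isolated or a leaf of
  what is left.
\<close>

fun leaf_order :: "('a \<Rightarrow> 'a \<Rightarrow> bool) \<Rightarrow> 'a list \<Rightarrow> bool" where
  "leaf_order A [] = True"
| "leaf_order A (v # vs) = (length (filter (A v) vs) \<le> 1 \<and> leaf_order A vs)"

lemma leaf_order_append: "leaf_order A (ys @ zs) \<Longrightarrow> leaf_order A zs"
  by (induction ys) auto

lemma leaf_order_cong:
  assumes "leaf_order A vs" "\<And>v w. v \<in> set vs \<Longrightarrow> w \<in> set vs \<Longrightarrow> A v w = B v w"
  shows "leaf_order B vs"
  using assms
proof (induction vs)
  case (Cons v vs)
  then have "filter (A v) vs = filter (B v) vs"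
    by (intro filter_cong) auto
  with Cons show ?case by simp
qed simp

text \<open>
  The vertex of a cycle that is deleted first still has its two neighbours on the cycle.
\<close>

lemma forest_if_leaf_order:
  assumes order: "leaf_order (\<lambda>v w. (v, w) \<in> parcs G) vs"
    and sym: "sym (parcs G)" and irrefl: "irrefl (parcs G)"
  shows "undirected_forest (with_proj G \<restriction> set vs)"
  unfolding undirected_forest_def
proof
  let ?H = "with_proj G \<restriction> set vs"
  assume "\<exists>p. pre_digraph.cycle ?H p \<and> 3 \<le> length p"
  then obtain p where p: "pre_digraph.cycle ?H p" "3 \<le> length p"
    by blast
  then have "set p \<subseteq> arcs ?H"
    by (auto simp: pre_digraph.cycle_def pre_digraph.awalk_def)
  define C where "C = snd ` set p"
  have sub: "C \<subseteq> set vs"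
    using \<open>set p \<subseteq> arcs ?H\<close> by (auto simp: C_def)
  have "C \<noteq> {}"
    using p(2) by (auto simp: C_def)
  with sub have "\<exists>v \<in> set vs. v \<in> C"
    by (meson ex_in_conv subsetD)
  from split_list_first_prop[OF this]
  obtain ys w zs where split: "vs = ys @ w # zs" and w: "w \<in> C"
    and first: "\<forall>v \<in> set ys. v \<notin> C"
    by auto
  obtain x y where xy: "x \<in> C" "y \<in> C" "x \<noteq> y"
      "(x, w) \<in> parcs G" "(w, y) \<in> parcs G"
    using cycle_vertex_two_neighbours[OF p] w unfolding C_def by meson
  then have wx: "(w, x) \<in> parcs G" and ne: "x \<noteq> w" "y \<noteq> w"
    using symD[OF sym] irrefl by (auto simp: irrefl_def)
  have "set ys \<inter> C = {}"
    using first by blast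
  then have "x \<in> set zs" "y \<in> set zs"
    using xy(1,2) ne sub unfolding split by auto
  with wx have "{x, y} \<subseteq> set (filter (\<lambda>v. (w, v) \<in> parcs G) zs)"
    using xy by auto
  then have "card {x, y} \<le> length (filter (\<lambda>v. (w, v) \<in> parcs G) zs)"
    by (meson List.finite_set card_length card_mono le_trans)
  moreover have "length (filter (\<lambda>v. (w, v) \<in> parcs G) zs) \<le> 1"
    using leaf_order_append[OF order[unfolded split]] by simp
  ultimately show False
    using xy(3) by simp
qed

section \<open>Straight-line drawings from barycentric coordinates\<close>

text \<open>
  Schnyder's barycentric representations. In the plane of the points with
  coordinate sum \<open>c\<close>, the points without a coordinate that exceeds both the coordinate of \<open>u\<close> and that
  of \<open>v\<close> form a triangle with \<open>u\<close> and \<open>v\<close> on its boundary. The last assumption says that it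
  contains no other vertex when \<open>u\<close> and \<open>v\<close> are adjacent.
\<close>

locale barycentric =
  fixes G :: "'a::linorder pair_pre_digraph" and x :: "nat \<Rightarrow> 'a \<Rightarrow> real" and c :: real
  assumes graph: "pair_graph G"
    and sum: "v \<in> pverts G \<Longrightarrow> x 0 v + x 1 v + x 2 v = c"
    and inj: "inj_on (\<lambda>v. (x 0 v, x 1 v)) (pverts G)"
    and dominated: "(u, v) \<in> parcs G \<Longrightarrow> w \<in> pverts G \<Longrightarrow> w \<noteq> u \<Longrightarrow> w \<noteq> v \<Longrightarrow>
      \<exists>k<3. x k u < x k w \<and> x k v < x k w"
begin

definition pos :: "'a \<Rightarrow> complex" where
  "pos v = Complex (x 0 v) (x 1 v)"

text \<open>
  The extension of \<open>x k\<close> to an affine function on the plane; the third coordinate is recovered from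
  the constant sum.
\<close>

definition coord :: "nat \<Rightarrow> complex \<Rightarrow> real" where
  "coord k z = (if k = 0 then Re z else if k = 1 then Im z else c - Re z - Im z)"

lemma coord_pos: "v \<in> pverts G \<Longrightarrow> k < 3 \<Longrightarrow> coord k (pos v) = x k v"
  using sum[of v] by (auto simp: coord_def pos_def less_Suc_eq numeral_3_eq_3 numeral_2_eq_2)

lemma coord_segment:
  assumes "z = (1 - t) *\<^sub>R a + t *\<^sub>R b"
  shows "coord k z = (1 - t) * coord k a + t * coord k b"
  unfolding assms by (simp add: coord_def algebra_simps)

lemma coord_closed_segment:
  assumes "z \<in> closed_segment a b"
  shows "coord k z \<le> max (coord k a) (coord k b)" "min (coord k a) (coord k b) \<le> coord k z"
proof -
  obtain t where t: "0 \<le> t" "t \<le> 1" "z = (1 - t) *\<^sub>R a + t *\<^sub>R b"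
    using assms by (auto simp: in_segment)
  have z: "coord k z = (1 - t) * coord k a + t * coord k b"
    by (rule coord_segment[OF t(3)])
  show "coord k z \<le> max (coord k a) (coord k b)"
    unfolding z using t by (intro convex_bound_le) auto
  have "(1 - t) * (- coord k a) + t * (- coord k b) \<le> - min (coord k a) (coord k b)"
    using t by (intro convex_bound_le) auto
  then show "min (coord k a) (coord k b) \<le> coord k z"
    unfolding z by simp
qed

lemma arc_verts: "(u, v) \<in> parcs G \<Longrightarrow> u \<in> pverts G \<and> v \<in> pverts G \<and> u \<noteq> v"
proof -
  interpret pair_graph G by (rule graph)
  show "(u, v) \<in> parcs G \<Longrightarrow> u \<in> pverts G \<and> v \<in> pverts G \<and> u \<noteq> v"
    using wellformed' pair_no_loops by fastforce
qed

lemma inj_pos: "inj_on pos (pverts G)"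
  using inj by (auto simp: inj_on_def pos_def)

lemma vertex_not_on_edge:
  assumes "(u, v) \<in> parcs G" "w \<in> pverts G" "pos w \<in> closed_segment (pos u) (pos v)"
  shows "w \<in> {u, v}"
proof (rule ccontr)
  assume "w \<notin> {u, v}"
  then obtain k where k: "k < 3" "x k u < x k w" "x k v < x k w"
    using dominated assms by blast
  with coord_closed_segment(1)[OF assms(3), of k] show False
    using assms(2) arc_verts[OF assms(1)] by (simp add: coord_pos)
qed

text \<open>
  Four applications of the domination property, one for each end point against the other edge, give
  four coordinates. A coordinate \<open>i\<close> or \<open>j\<close> where an end of the second edge dominates the first edge
  differs from a coordinate \<open>k\<close> or \<open>l\<close> where an end of the first edge dominates the second. As there are
  only three coordinates, \<open>i = j\<close> or \<open>k = l\<close>, and this coordinate separates the edges.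
\<close>

lemma disjoint_edges:
  assumes uv: "(u, v) \<in> parcs G" and pq: "(p, q) \<in> parcs G" and disj: "{u, v} \<inter> {p, q} = {}"
  shows "closed_segment (pos u) (pos v) \<inter> closed_segment (pos p) (pos q) = {}"
proof (rule ccontr)
  assume "\<not> ?thesis"
  then obtain z where z: "z \<in> closed_segment (pos u) (pos v)" "z \<in> closed_segment (pos p) (pos q)"
    by blast
  note V = arc_verts[OF uv] arc_verts[OF pq]
  obtain i j k l where
    i: "i < 3" "x i u < x i p" "x i v < x i p" and j: "j < 3" "x j u < x j q" "x j v < x j q" and
    k: "k < 3" "x k p < x k u" "x k q < x k u" and l: "l < 3" "x l p < x l v" "x l q < x l v"
    using dominated[OF uv, of p] dominated[OF uv, of q] dominated[OF pq, of u] dominated[OF pq, of v]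
      V disj by auto
  have "i \<noteq> k" "i \<noteq> l" "j \<noteq> k" "j \<noteq> l"
    using i j k l by (auto dest: less_asym)
  then consider "i = j" | "k = l"
    using i(1) j(1) k(1) l(1) by linarith
  then show False
  proof cases
    case 1
    with coord_closed_segment(1)[OF z(1), of i] coord_closed_segment(2)[OF z(2), of i] show False
      using i j V by (simp add: coord_pos)
  next
    case 2
    with coord_closed_segment(2)[OF z(1), of k] coord_closed_segment(1)[OF z(2), of k] show False
      using k l V by (simp add: coord_pos)
  qed
qed

text \<open>
  Let \<open>s\<close> and \<open>t\<close> be the positions of a common point on the two edges. The coordinate in which \<open>v\<close>
  dominates \<open>uw\<close> yields \<open>s < t\<close>, the coordinate in which \<open>w\<close> dominates \<open>uv\<close> yields \<open>t < s\<close>, unless the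
  point is the common end.
\<close>

lemma adjacent_edges:
  assumes uv: "(u, v) \<in> parcs G" and uw: "(u, w) \<in> parcs G" and vw: "v \<noteq> w"
  shows "closed_segment (pos u) (pos v) \<inter> closed_segment (pos u) (pos w) \<subseteq> {pos u}"
proof
  fix z assume "z \<in> closed_segment (pos u) (pos v) \<inter> closed_segment (pos u) (pos w)"
  then obtain s t where s: "0 \<le> s" "z = (1 - s) *\<^sub>R pos u + s *\<^sub>R pos v"
    and t: "0 \<le> t" "z = (1 - t) *\<^sub>R pos u + t *\<^sub>R pos w"
    by (auto simp: in_segment)
  note V = arc_verts[OF uv] arc_verts[OF uw]
  have eq: "s * (x k v - x k u) = t * (x k w - x k u)" if "k < 3" for k
  proof -
    have "(1 - s) * x k u + s * x k v = (1 - t) * x k u + t * x k w"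
      using coord_segment[OF s(2), of k] coord_segment[OF t(2), of k] V that by (simp add: coord_pos)
    then show ?thesis by (simp add: algebra_simps)
  qed
  obtain k l where k: "k < 3" "x k u < x k v" "x k w < x k v"
    and l: "l < 3" "x l u < x l w" "x l v < x l w"
    using dominated[OF uw, of v] dominated[OF uv, of w] V vw by auto
  have "s = 0"
  proof (rule ccontr)
    assume "s \<noteq> 0"
    then have "s > 0" using s(1) by simp
    then have "0 < t * (x k w - x k u)"
      using eq[OF k(1)] k by (metis diff_gt_0_iff_gt mult_pos_pos)
    then have "t > 0"
      using t(1) by (auto simp: zero_less_mult_iff)
    have "t * (x k w - x k u) < t * (x k v - x k u)"
      using \<open>t > 0\<close> k by simp
    then have "s * (x k v - x k u) < t * (x k v - x k u)"
      using eq[OF k(1)] by simp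
    then have "s < t"
      using k by (simp add: mult_less_cancel_right)
    have "s * (x l v - x l u) < s * (x l w - x l u)"
      using \<open>s > 0\<close> l by simp
    then have "t * (x l w - x l u) < s * (x l w - x l u)"
      using eq[OF l(1)] by simp
    then have "t < s"
      using l by (simp add: mult_less_cancel_right)
    with \<open>s < t\<close> show False by simp
  qed
  then show "z \<in> {pos u}"
    using s by simp
qed

text \<open>
  An edge is an unordered pair, and a curve has a direction; the order of the vertices selects one.
\<close>

definition straight :: "'a set \<Rightarrow> real \<Rightarrow> complex" where
  "straight e = linepath (pos (Min e)) (pos (Max e))"

lemma straight_edge:
  assumes "(u, v) \<in> parcs G"
  shows "path_image (straight {u, v}) = closed_segment (pos u) (pos v)"
    "arc (straight {u, v})"
    "{pathstart (straight {u, v}), pathfinish (straight {u, v})} = pos ` {u, v}"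
proof -
  have mm: "{Min {u, v}, Max {u, v}} = {u, v}"
    by (auto simp: min_def max_def)
  have "Min {u, v} \<noteq> Max {u, v}"
    using arc_verts[OF assms] mm by auto
  moreover have "Min {u, v} \<in> pverts G" "Max {u, v} \<in> pverts G"
    using arc_verts[OF assms] by (auto simp: min_def max_def)
  ultimately show "arc (straight {u, v})"
    unfolding straight_def using inj_onD[OF inj_pos] by (intro arc_linepath) blast
  show "path_image (straight {u, v}) = closed_segment (pos u) (pos v)"
    by (auto simp: straight_def min_def max_def closed_segment_commute)
  show "{pathstart (straight {u, v}), pathfinish (straight {u, v})} = pos ` {u, v}"
    by (auto simp: straight_def min_def max_def)
qed

lemma plane_drawing_straight: "plane_drawing G pos straight"
  unfolding plane_drawing_def
proof (intro conjI ballI impI)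
  show "inj_on pos (pverts G)"
    by (rule inj_pos)
next
  fix e assume "e \<in> edges G"
  then obtain u v where e: "e = {u, v}" "(u, v) \<in> parcs G"
    by (auto simp: edges_def)
  then show "arc (straight e)" "{pathstart (straight e), pathfinish (straight e)} = pos ` e"
    using straight_edge(2,3) by simp_all
  fix w assume "w \<in> pverts G" "pos w \<in> path_image (straight e)"
  then show "w \<in> e"
    using vertex_not_on_edge[of u v w] straight_edge(1)[OF e(2)] e by simp
next
  fix e f assume "e \<in> edges G" "f \<in> edges G" and ne: "e \<noteq> f"
  then obtain u v p q where e: "e = {u, v}" "(u, v) \<in> parcs G" and f: "f = {p, q}" "(p, q) \<in> parcs G"
    by (auto simp: edges_def)
  interpret pair_graph G by (rule graph)
  have sym: "(v, u) \<in> parcs G" "(q, p) \<in> parcs G"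
    using e(2) f(2) arcs_symmetric by auto
  have img: "path_image (straight e) = closed_segment (pos u) (pos v)"
    "path_image (straight f) = closed_segment (pos p) (pos q)"
    using straight_edge(1) e f by simp_all
  show "path_image (straight e) \<inter> path_image (straight f) \<subseteq> pos ` (e \<inter> f)"
  proof (cases "e \<inter> f = {}")
    case True
    then show ?thesis
      using disjoint_edges[OF e(2) f(2)] e(1) f(1) img by simp
  next
    case False
    then consider "u = p" "v \<noteq> q" | "u = q" "v \<noteq> p" | "v = p" "u \<noteq> q" | "v = q" "u \<noteq> p"
      using ne e(1) f(1) by auto
    then show ?thesis
      using adjacent_edges[of u v q] adjacent_edges[of u v p] adjacent_edges[of v u q]
        adjacent_edges[of v u p] e(2) f(2) sym unfolding img unfolding e(1) f(1)
      by cases (auto simp: closed_segment_commute)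
  qed
qed

end

section \<open>Lower bounds for cycle transversals by case distinction\<close>

text \<open>
  A tree of case distinctions that bounds from below the number of vertices outside a set that contains
  no cycle. \<open>Packing ks\<close> refers to the cycles with indices \<open>ks\<close> in a given list, and \<open>Split v s t\<close> treats
  by \<open>s\<close> the case that \<open>v\<close> belongs to the set and by \<open>t\<close> the case that it does not.
\<close>

datatype case_tree = Packing "nat list" | Split nat case_tree case_tree

text \<open>
  The lists \<open>K\<close> and \<open>R\<close> collect the vertices that are known to be inside and outside of the set. A cycle
  has a missing vertex, which is not in \<open>K\<close>, so only the part of the cycle outside \<open>K\<close> matters and it
  cannot be empty. If these parts are disjoint from each other and from \<open>R\<close>, they contain as many missing
  vertices that are not in \<open>R\<close>. In the second case of a split the vertex \<open>v\<close> itself is one of the \<open>m\<close>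
  missing vertices.
\<close>

fun forces :: "nat list list \<Rightarrow> nat list \<Rightarrow> nat list \<Rightarrow> nat \<Rightarrow> case_tree \<Rightarrow> bool" where
  "forces cs K R m (Packing ks) =
     (list_all (\<lambda>i. i < length cs) ks \<and>
      (let parts = map (\<lambda>i. filter (\<lambda>x. x \<notin> set K) (cs ! i)) ks in
         [] \<in> set parts \<or>
         m \<le> length ks \<and> distinct (concat parts) \<and> list_all (\<lambda>x. x \<notin> set R) (concat parts)))"
| "forces cs K R m (Split v s t) =
     (v \<notin> set R \<and> forces cs (v # K) R m s \<and> forces cs K (v # R) (m - 1) t)"

fun split_vertices :: "case_tree \<Rightarrow> nat list" where
  "split_vertices (Packing ks) = []"
| "split_vertices (Split v s t) = v # split_vertices s @ split_vertices t"

lemma card_ge_packing: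
  assumes "distinct (concat parts)" "\<forall>P \<in> set parts. \<exists>x \<in> set P. x \<in> A" "finite A"
  shows "length parts \<le> card A"
  using assms
proof (induction parts arbitrary: A)
  case Nil
  then show ?case by simp
next
  case (Cons P parts)
  then obtain x where x: "x \<in> set P" "x \<in> A" by auto
  have "\<forall>Q \<in> set parts. \<exists>y \<in> set Q. y \<in> A - {x}"
  proof
    fix Q assume Q: "Q \<in> set parts"
    then obtain y where y: "y \<in> set Q" "y \<in> A"
      using Cons.prems(2) by auto
    have "set P \<inter> set (concat parts) = {}"
      using Cons.prems(1) by simp
    moreover have "y \<in> set (concat parts)"
      using Q y(1) by auto
    ultimately have "y \<noteq> x"
      using x(1) by blast
    with y show "\<exists>y \<in> set Q. y \<in> A - {x}" by blast
  qed
  moreover have "distinct (concat parts)" "finite (A - {x})"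
    using Cons.prems by simp_all
  ultimately have "length parts \<le> card (A - {x})"
    by (intro Cons.IH)
  then show ?case
    using card.remove[OF Cons.prems(3) x(2)] by simp
qed

lemma forces_sound:
  assumes "forces cs K R m t" "finite V" "set (split_vertices t) \<subseteq> V" "\<forall>c \<in> set cs. set c \<subseteq> V \<and> \<not> set c \<subseteq> X"
    "set K \<subseteq> X" "set R \<inter> X = {}"
  shows "m \<le> card (V - X - set R)"
  using assms
proof (induction t arbitrary: K R m)
  case (Packing ks)
  define part where "part i = filter (\<lambda>x. x \<notin> set K) (cs ! i)" for i
  have idx: "\<forall>i \<in> set ks. i < length cs"
    and pack: "[] \<in> set (map part ks) \<or> m \<le> length ks \<and> distinct (concat (map part ks)) \<and>
      (\<forall>x \<in> set (concat (map part ks)). x \<notin> set R)"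
    using Packing.prems(1) unfolding forces.simps Let_def list_all_iff part_def by blast+
  have hit: "\<exists>x \<in> set (part i). x \<in> V - X" if "i \<in> set ks" for i
  proof -
    have "cs ! i \<in> set cs"
      using idx that by simp
    then obtain x where "x \<in> set (cs ! i)" "x \<in> V" "x \<notin> X"
      using Packing.prems(4) by blast
    then show ?thesis
      using Packing.prems(5) by (auto simp: part_def)
  qed
  have "[] \<notin> set (map part ks)"
  proof
    assume "[] \<in> set (map part ks)"
    then obtain i where "i \<in> set ks" "part i = []"
      by auto
    with hit[of i] show False by simp
  qed
  with pack have len: "m \<le> length (map part ks)" and dist: "distinct (concat (map part ks))"
    and avoid: "\<forall>x \<in> set (concat (map part ks)). x \<notin> set R"
    by simp_all
  have "\<forall>P \<in> set (map part ks). \<exists>x \<in> set P. x \<in> V - X - set R"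
  proof
    fix P assume "P \<in> set (map part ks)"
    then obtain i where i: "P = part i" "i \<in> set ks"
      by auto
    obtain x where x: "x \<in> set (part i)" "x \<in> V - X"
      using hit[OF i(2)] by blast
    then have "x \<notin> set R"
      using avoid i(2) by auto
    with x i(1) show "\<exists>x \<in> set P. x \<in> V - X - set R"
      by blast
  qed
  from card_ge_packing[OF dist this] Packing.prems(2)
  have "length (map part ks) \<le> card (V - X - set R)"
    by simp
  with len show ?case
    by linarith
next
  case (Split v s t)
  show ?case
  proof (cases "v \<in> X")
    case True
    then show ?thesis
      using Split.prems by (intro Split.IH(1)[of "v # K"]) auto
  next
    case False
    then have "m - 1 \<le> card (V - X - set (v # R))"
      using Split.prems by (intro Split.IH(2)) auto
    also have "V - X - set (v # R) = V - X - set R - {v}"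
      by auto
    finally have "m - 1 \<le> card (V - X - set R - {v})" .
    moreover have "card (V - X - set R) = Suc (card (V - X - set R - {v}))"
      using False Split.prems by (intro card.remove) auto
    ultimately show ?thesis
      by linarith
  qed
qed

section \<open>The gadget\<close>

text \<open>
  The vertices \<open>0, 1, 2\<close> form the boundary triangle. Inside it, vertex \<open>3\<close> is joined to all three of them
  and vertex \<open>4\<close> to \<open>0, 2, 3\<close>; the remaining vertices fill the triangle \<open>2, 3, 4\<close> by a triangulation
  without further separating triangles.
\<close>

definition gadget_edges :: "(nat \<times> nat) list" where
  "gadget_edges = [
     (0, 1), (0, 2), (0, 3), (0, 4), (1, 2), (1, 3), (2, 3), (2, 4), (2, 6), (2, 10), (3, 4),
     (3, 5), (3, 6), (4, 5), (4, 8), (4, 9), (4, 10), (5, 6), (5, 7), (5, 8), (6, 7), (6, 10),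
     (6, 11), (7, 8), (7, 11), (7, 12), (7, 13), (8, 9), (8, 13), (8, 14), (9, 10), (9, 14),
     (9, 15), (9, 16), (10, 11), (10, 16), (11, 12), (11, 16), (11, 17), (12, 13), (12, 17),
     (12, 18), (13, 14), (13, 18), (14, 15), (14, 18), (15, 16), (15, 17), (15, 18), (16, 17),
     (17, 18)]"

text \<open>
  These are the chordless cycles that the case distinctions below refer to, sorted by the number of
  references.
\<close>

definition gadget_cycles :: "nat list list" where
  "gadget_cycles = [
     [12, 13, 18], [14, 15, 18], [9, 15, 16], [13, 14, 18], [15, 17, 18], [12, 17, 18], [3, 5, 6],
     [11, 12, 17], [8, 13, 14], [3, 4, 5], [9, 14, 15], [15, 16, 17], [2, 6, 10], [11, 16, 17],
     [5, 6, 7], [2, 4, 5, 6], [5, 7, 8], [8, 9, 14], [7, 12, 13], [9, 10, 16], [4, 5, 8],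
     [10, 11, 16], [7, 8, 13], [4, 8, 9], [7, 11, 12], [3, 4, 10, 6], [6, 7, 11], [3, 4, 8, 7, 6],
     [9, 10, 11, 17, 15], [8, 9, 15, 18, 13], [7, 11, 17, 15, 14, 13], [6, 10, 11],
     [8, 9, 15, 17, 12, 13], [11, 12, 18, 15, 16], [7, 11, 17, 18, 13], [9, 14, 13, 12, 17, 16],
     [5, 6, 11, 12, 13, 8], [5, 6, 11, 16, 9, 8], [9, 10, 11, 12, 18, 15],
     [8, 9, 10, 11, 17, 18, 13], [8, 9, 10, 11, 12, 13], [9, 14, 18, 12, 11, 16],
     [9, 14, 13, 12, 11, 16], [11, 12, 13, 14, 15, 16], [9, 10, 11, 17, 18, 14],
     [7, 11, 10, 9, 15, 18, 13], [4, 9, 10], [7, 11, 10, 9, 14, 13], [9, 14, 18, 17, 16],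
     [7, 8, 14, 18, 12], [5, 6, 11, 16, 15, 14, 8], [5, 6, 11, 12, 18, 14, 8],
     [5, 6, 11, 16, 15, 18, 13, 8], [5, 6, 11, 17, 15, 9, 8], [5, 6, 11, 17, 18, 13, 8],
     [5, 6, 11, 12, 18, 15, 9, 8], [8, 9, 16, 17, 12, 13], [8, 9, 16, 17, 18, 13],
     [4, 5, 7, 13, 14, 9], [7, 8, 9, 10, 11], [7, 8, 9, 15, 17, 11], [6, 7, 8, 9, 10],
     [4, 8, 7, 11, 10], [7, 8, 14, 15, 17, 12], [6, 7, 12, 17, 16, 10], [4, 8, 7, 12, 17, 16, 10],
     [4, 8, 14, 18, 17, 16, 10], [6, 7, 8, 14, 18, 17, 16, 10], [4, 8, 14, 15, 16, 10],
     [6, 7, 8, 14, 15, 16, 10], [6, 7, 12, 18, 15, 16, 10], [4, 8, 7, 12, 18, 15, 16, 10],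
     [3, 4, 8, 13, 18, 15, 16, 11, 6], [3, 4, 8, 13, 12, 11, 6], [3, 4, 8, 14, 15, 16, 11, 6],
     [3, 4, 8, 14, 18, 12, 11, 6], [3, 4, 9, 16, 17, 18, 13, 7, 6], [3, 4, 9, 14, 18, 12, 7, 6],
     [3, 4, 9, 16, 17, 12, 7, 6], [3, 4, 9, 14, 13, 7, 6], [4, 5, 6, 10], [12, 13, 14, 15, 17],
     [0, 2, 3], [0, 2, 4], [1, 2, 3], [2, 4, 10], [2, 4, 8, 7, 6], [4, 5, 7, 11, 17, 18, 14, 9],
     [4, 5, 7, 11, 17, 15, 9], [7, 11, 16, 15, 14, 13], [7, 11, 16, 15, 18, 13],
     [4, 5, 7, 13, 18, 15, 9], [4, 5, 7, 11, 16, 9], [2, 4, 9, 14, 18, 12, 7, 6],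
     [4, 5, 7, 12, 18, 14, 9], [4, 5, 7, 12, 17, 16, 9], [2, 4, 9, 16, 17, 12, 7, 6],
     [2, 4, 9, 14, 13, 7, 6], [2, 4, 9, 16, 17, 18, 13, 7, 6], [4, 5, 7, 13, 18, 17, 16, 9],
     [2, 4, 8, 13, 18, 15, 16, 11, 6], [2, 4, 8, 14, 18, 12, 11, 6], [2, 4, 8, 13, 12, 11, 6],
     [2, 4, 8, 14, 15, 16, 11, 6]]"

definition inner_tree :: case_tree where
  "inner_tree =
     Split 8 (Split 7 (Split 13 (Packing [22]) (Split 5 (Packing [16]) (Split 9 (Split 14 (Packing
     [17]) (Split 4 (Packing [23]) (Split 11 (Packing [26, 59, 24, 60]) (Packing [61, 2, 5]))))
     (Split 11 (Packing [62, 26, 24, 13, 1]) (Split 17 (Split 15 (Packing [27, 63, 11, 4]) (Split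
     12 (Split 18 (Packing [5]) (Split 6 (Packing [27, 64]) (Packing [65]))) (Split 4 (Packing
     [27, 66]) (Packing [67])))) (Split 14 (Split 18 (Packing [27, 49, 1]) (Split 4 (Packing [27,
     68]) (Packing [69]))) (Split 6 (Packing [27, 70]) (Packing [71])))))))) (Split 9 (Split 14
     (Packing [17]) (Split 4 (Packing [23]) (Split 16 (Packing [6, 19, 2, 13, 0]) (Split 18 (Split
     12 (Packing [6, 38, 0, 5]) (Split 15 (Packing [6, 29, 4]) (Packing [6, 39]))) (Split 11
     (Split 10 (Packing [31, 40, 28]) (Packing [6, 7])) (Packing [6, 32])))))) (Split 17 (Split 11
     (Packing [7, 13, 8, 20, 31, 4]) (Split 18 (Split 12 (Packing [5]) (Split 15 (Packing [4])
     (Split 4 (Packing [25, 20, 8]) (Packing [6, 8])))) (Split 5 (Packing [6, 20, 8, 11]) (Packing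
     [25, 8, 11])))) (Split 13 (Split 14 (Packing [8]) (Split 5 (Packing [6, 20, 21, 0]) (Split 10
     (Packing [25, 21, 0]) (Split 18 (Packing [72, 0]) (Packing [73]))))) (Split 5 (Packing [6,
     20, 21, 1]) (Split 10 (Packing [25, 21, 1]) (Split 15 (Split 18 (Packing [33, 1]) (Packing
     [74])) (Packing [75])))))))) (Split 11 (Split 16 (Split 10 (Packing [21]) (Split 17 (Packing
     [13]) (Split 12 (Split 7 (Packing [24]) (Split 18 (Packing [0, 41, 9, 33]) (Split 9 (Packing
     [42, 2, 6]) (Packing [9, 43])))) (Packing [9, 26, 2, 3])))) (Split 7 (Split 12 (Packing [24])
     (Split 6 (Packing [26]) (Split 18 (Split 17 (Packing [9, 44, 34, 4]) (Split 14 (Packing [9,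
     3, 1]) (Packing [9, 45]))) (Split 4 (Packing [9, 46, 30]) (Split 15 (Split 14 (Packing [10,
     30]) (Packing [28])) (Packing [47])))))) (Split 18 (Split 12 (Packing [0, 7, 9, 31, 1])
     (Packing [3, 46, 6, 4])) (Packing [7, 10, 9, 31])))) (Split 18 (Split 15 (Split 14 (Packing
     [1]) (Split 17 (Packing [4]) (Split 5 (Packing [9, 14, 2, 0]) (Packing [25, 2, 0])))) (Split
     13 (Split 12 (Packing [0]) (Split 14 (Packing [3]) (Split 5 (Packing [9, 14, 19]) (Split 10
     (Packing [25, 19]) (Packing [76]))))) (Split 5 (Packing [9, 14, 19, 5]) (Split 10 (Packing
     [25, 19, 5]) (Split 17 (Packing [48, 5]) (Packing [77])))))) (Split 9 (Split 16 (Split 10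
     (Packing [19]) (Split 15 (Packing [2]) (Split 5 (Packing [9, 14, 35]) (Split 12 (Split 13
     (Packing [18, 35]) (Packing [78])) (Packing [79]))))) (Packing [46, 6, 18, 10])) (Split 5
     (Split 6 (Packing [6, 80, 14, 81]) (Packing [9, 18, 11])) (Packing [25, 18, 11])))))"

definition tree_02 :: case_tree where
  "tree_02 =
     Split 3 (Packing [82]) (Split 4 (Packing [83]) (Split 11 (Split 7 (Split 12 (Packing [24])
     (Split 6 (Packing [26]) (Split 8 (Packing [16, 22, 21, 17, 4]) (Split 16 (Packing [21, 13, 2,
     3]) (Split 14 (Split 15 (Packing [10, 30, 1]) (Split 13 (Packing [47, 3]) (Packing [44])))
     (Split 17 (Packing [28, 34]) (Packing [45]))))))) (Split 16 (Split 10 (Packing [21]) (Split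
     17 (Packing [13]) (Split 14 (Split 9 (Split 8 (Packing [17]) (Split 15 (Packing [10]) (Split
     12 (Packing [42, 41]) (Packing [3])))) (Split 13 (Packing [8, 43, 3]) (Split 15 (Packing [50,
     1]) (Packing [51])))) (Split 15 (Split 9 (Packing [2]) (Split 18 (Packing [52, 33]) (Packing
     [36]))) (Packing [0, 37]))))) (Split 14 (Split 18 (Packing [3, 1, 12, 17, 7]) (Packing [12,
     7, 8, 10])) (Split 17 (Split 12 (Packing [7]) (Split 15 (Split 18 (Packing [4]) (Split 10
     (Packing [12, 28]) (Packing [53]))) (Split 10 (Packing [12, 39]) (Packing [54])))) (Split 10
     (Split 6 (Packing [12]) (Split 12 (Split 18 (Packing [38, 0]) (Packing [40])) (Packing
     [29]))) (Split 13 (Split 12 (Packing [36, 0]) (Packing [29])) (Packing [55]))))))) (Split 15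
     (Split 18 (Packing [12, 16, 2, 0, 1, 4]) (Split 7 (Packing [12, 16, 18, 10, 11]) (Split 9
     (Packing [12, 32, 10, 2]) (Packing [12, 8, 11])))) (Split 13 (Split 7 (Packing [14, 22, 19,
     18, 3]) (Split 14 (Packing [12, 8, 35, 3]) (Split 10 (Packing [12, 19, 0]) (Split 12 (Packing
     [56, 0]) (Packing [57]))))) (Split 6 (Packing [14, 17, 12, 5]) (Packing [16, 19, 5]))))))"

definition tree_12 :: case_tree where
  "tree_12 =
     Split 3 (Packing [84]) (Split 10 (Split 4 (Packing [85]) (Split 6 (Packing [12]) (Split 16
     (Split 9 (Packing [19]) (Split 11 (Packing [21]) (Split 13 (Split 8 (Packing [22, 0, 8, 11])
     (Packing [18, 3, 11])) (Split 15 (Packing [16, 1, 11]) (Packing [16, 5]))))) (Split 13 (Split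
     18 (Split 12 (Packing [0]) (Split 14 (Packing [3]) (Split 15 (Split 17 (Packing [4]) (Split 8
     (Packing [22, 29]) (Packing [45]))) (Split 7 (Packing [22, 34]) (Packing [39]))))) (Split 7
     (Split 8 (Packing [22]) (Split 12 (Packing [18]) (Split 9 (Split 14 (Packing [47, 10])
     (Packing [28])) (Packing [30])))) (Split 14 (Packing [8, 10, 7]) (Split 11 (Split 17 (Packing
     [28, 7]) (Packing [40])) (Packing [32]))))) (Split 17 (Split 18 (Packing [16, 44, 5, 4])
     (Packing [16, 7, 10])) (Split 14 (Packing [24, 17, 1]) (Packing [16, 38]))))))) (Split 7
     (Split 8 (Split 13 (Packing [22]) (Split 5 (Packing [16]) (Split 11 (Packing [23, 26, 24, 13,
     1]) (Split 9 (Packing [23, 17, 2, 5]) (Packing [86, 11, 49]))))) (Split 11 (Split 12 (Packing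
     [24]) (Split 6 (Packing [26]) (Split 17 (Split 16 (Packing [13]) (Split 18 (Packing [87, 34,
     4]) (Split 15 (Packing [88, 30]) (Packing [58])))) (Split 15 (Split 14 (Packing [10, 89, 1])
     (Split 16 (Packing [2, 90]) (Packing [91]))) (Packing [3, 92]))))) (Split 15 (Split 18
     (Packing [1, 2, 14, 18, 4]) (Packing [18, 14, 10, 11])) (Split 12 (Split 13 (Packing [18])
     (Split 18 (Split 17 (Packing [5]) (Split 6 (Packing [93, 14]) (Packing [94]))) (Split 5
     (Packing [95, 14]) (Packing [96])))) (Split 6 (Split 5 (Packing [14]) (Split 13 (Split 14
     (Packing [97, 3]) (Packing [98])) (Packing [48]))) (Split 14 (Split 18 (Packing [48, 3])
     (Packing [58])) (Packing [99]))))))) (Split 18 (Split 15 (Split 14 (Packing [1]) (Split 17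
     (Packing [4]) (Split 9 (Split 16 (Packing [2]) (Split 8 (Packing [23, 55, 29]) (Packing [15,
     0]))) (Split 12 (Packing [15, 33, 0]) (Split 5 (Split 4 (Packing [15, 20]) (Packing [52]))
     (Packing [100])))))) (Split 12 (Split 13 (Packing [0]) (Split 17 (Packing [5]) (Split 8
     (Split 4 (Packing [20, 101, 23]) (Split 14 (Packing [51, 17]) (Packing [37]))) (Packing [15,
     41])))) (Split 14 (Packing [3, 15, 17, 13]) (Split 4 (Packing [13, 15, 23]) (Split 17 (Split
     16 (Packing [57, 13]) (Packing [54])) (Packing [37])))))) (Split 9 (Split 8 (Split 14
     (Packing [17]) (Split 4 (Packing [23]) (Split 16 (Packing [37, 56, 2]) (Split 17 (Split 12
     (Packing [7, 32]) (Packing [53])) (Packing [36]))))) (Split 15 (Packing [15, 7, 10, 2])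
     (Split 11 (Split 17 (Packing [15, 7, 13]) (Packing [15, 42])) (Packing [15, 35])))) (Split 17
     (Packing [7, 15, 8, 11]) (Split 8 (Split 13 (Split 14 (Packing [8]) (Split 4 (Packing [20,
     102]) (Packing [36]))) (Split 4 (Packing [20, 103]) (Packing [50]))) (Packing [15, 43])))))))"

definition cycle_in :: "(nat \<times> nat) list \<Rightarrow> nat list \<Rightarrow> bool" where
  "cycle_in es c \<longleftrightarrow> 3 \<le> length c \<and> distinct c \<and>
     list_all (\<lambda>(u, v). (u, v) \<in> set es \<or> (v, u) \<in> set es) (zip c (rotate1 c))"

lemma cycle_in_gadget_cycles: "list_all (cycle_in gadget_edges) gadget_cycles"
  by code_simp

lemma gadget_cycles_bounded: "list_all (list_all (\<lambda>v. v < 19)) gadget_cycles"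
  by code_simp

lemma split_vertices_bounded:
  "list_all (\<lambda>v. v < 19) (split_vertices inner_tree)"
  "list_all (\<lambda>v. v < 19) (split_vertices tree_02)"
  "list_all (\<lambda>v. v < 19) (split_vertices tree_12)"
  by code_simp+

text \<open>
  Boundary vertices that are not assumed to be in the forest are ignored by declaring them to be
  outside. The bounds \<open>8\<close> and \<open>9\<close> on the missing inner vertices leave \<open>8\<close> and \<open>7\<close> of the \<open>16\<close>.
\<close>

lemma forces_inner: "forces gadget_cycles [] [0, 1, 2] 8 inner_tree"
  by code_simp

lemma forces_02: "forces gadget_cycles [0, 2] [1] 9 tree_02"
  by code_simp

lemma forces_12: "forces gadget_cycles [1, 2] [0] 9 tree_12"
  by code_simp

text \<open>
  Each case applies one of the trees to the part of \<open>X\<close> that consists of inner vertices and of the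
  boundary vertices that are assumed to be in \<open>X\<close>.
\<close>

lemma gadget_bound:
  assumes free: "\<forall>c \<in> set gadget_cycles. \<not> set c \<subseteq> X"
  shows "card (X \<inter> {3..<19}) + (if 2 \<in> X \<and> (0 \<in> X \<or> 1 \<in> X) then 1 else 0) \<le> 8"
proof -
  have cycles: "\<forall>c \<in> set gadget_cycles. set c \<subseteq> {..<19}"
    using gadget_cycles_bounded by (auto simp: list_all_iff)
  have "card ({3..<19} - X \<union> X \<inter> {3..<19}) = card ({3..<19} - X) + card (X \<inter> {3..<19})"
    by (intro card_Un_disjoint) auto
  also have "{3..<19} - X \<union> X \<inter> {3..<19} = {3..<19}"
    by blast
  finally have missing: "card ({3..<19} - X) + card (X \<inter> {3..<19}) = 16"
    by simp
  have bound: "card (X \<inter> {3..<19}) \<le> 16 - m"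
    if "forces gadget_cycles K R m t" "list_all (\<lambda>v. v < 19) (split_vertices t)" "set K \<subseteq> X" "set K \<union> set R = {0, 1, 2}"
      "set K \<inter> set R = {}" "m \<le> 16" for K R m t
  proof -
    let ?Y = "X \<inter> (set K \<union> {3..<19})"
    have "set R \<subseteq> {0, 1, 2}"
      using that(4) by blast
    have "m \<le> card ({..<19} - ?Y - set R)"
    proof (rule forces_sound[OF that(1)])
      show "set (split_vertices t) \<subseteq> {..<19}"
        using that(2) by (auto simp: list_all_iff)
      show "\<forall>c \<in> set gadget_cycles. set c \<subseteq> {..<19} \<and> \<not> set c \<subseteq> ?Y"
        using cycles free by blast
      show "set K \<subseteq> ?Y" "set R \<inter> ?Y = {}"
        using that(3,5) \<open>set R \<subseteq> {0, 1, 2}\<close> by auto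
    qed simp
    also have "{..<19} - ?Y - set R = {3..<19} - X"
    proof (rule set_eqI)
      fix v :: nat
      have "v < 3 \<longleftrightarrow> v \<in> set K \<union> set R"
        unfolding that(4) by auto
      then show "v \<in> {..<19} - ?Y - set R \<longleftrightarrow> v \<in> {3..<19} - X"
        using that(3) \<open>set R \<subseteq> {0, 1, 2}\<close> by auto
    qed
    finally show ?thesis
      using that(6) missing by linarith
  qed
  have "card (X \<inter> {3..<19}) \<le> 8"
    using bound[OF forces_inner split_vertices_bounded(1)] by auto
  moreover have "card (X \<inter> {3..<19}) \<le> 7" if "2 \<in> X" "0 \<in> X"
    using bound[OF forces_02 split_vertices_bounded(2)] that by auto
  moreover have "card (X \<inter> {3..<19}) \<le> 7" if "2 \<in> X" "1 \<in> X"
    using bound[OF forces_12 split_vertices_bounded(3)] that by auto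
  ultimately show ?thesis
    by auto
qed

section \<open>The tetrahedron with three gadgets\<close>

text \<open>
  The tetrahedron has the centre \<open>0\<close> and the outer vertices \<open>1, 2, 3\<close>. The copy \<open>i\<close> of the gadget fills
  the face of the centre and the outer vertices \<open>i + 1\<close> and its cyclic successor. Vertex \<open>2\<close> of the gadget,
  at which both charged edges meet, becomes the vertex \<open>i + 1\<close>. So the copy \<open>i\<close> charges the edge from
  \<open>i + 1\<close> to the centre and the edge from \<open>i + 1\<close> to its successor, and together the three copies charge
  every edge of the tetrahedron once.
\<close>

definition place :: "nat \<Rightarrow> nat \<Rightarrow> nat" where
  "place i j = (if j = 0 then 0 else if j = 1 then Suc (Suc i mod 3) else if j = 2 then Suc i
     else 16 * i + j + 1)"

definition tetra_edges :: "(nat \<times> nat) list" where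
  "tetra_edges =
     concat (map (\<lambda>i. map (\<lambda>(u, v). (place i u, place i v)) gadget_edges) [0, 1, 2])"

definition tetra_graph :: "nat pair_pre_digraph" where
  "tetra_graph = \<lparr>pverts = {..<52}, parcs = set tetra_edges \<union> (set tetra_edges)\<inverse>\<rparr>"

lemma pverts_tetra_graph [simp]: "pverts tetra_graph = {..<52}"
  by (simp add: tetra_graph_def)

lemma parcs_tetra_graph: "parcs tetra_graph = {(u, v). (u, v) \<in> set tetra_edges \<or> (v, u) \<in> set tetra_edges}"
  by (auto simp: tetra_graph_def)

lemma tetra_edges_wf: "list_all (\<lambda>(u, v). u < 52 \<and> v < 52 \<and> u \<noteq> v) tetra_edges"
  by code_simp

lemma pair_graph_tetra_graph: "pair_graph tetra_graph"
proof
  show "finite (pverts tetra_graph)" "finite (parcs tetra_graph)"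
    by (simp_all add: tetra_graph_def)
  show "symmetric (with_proj tetra_graph)"
    by (auto simp: symmetric_def sym_def parcs_tetra_graph)
qed (use tetra_edges_wf in \<open>auto simp: parcs_tetra_graph list_all_iff\<close>)

text \<open>
  The coordinates are Schnyder's. A Schnyder wood is an orientation and partition of the inner edges into
  three trees, rooted at the outer vertices; the three tree paths of a vertex divide the drawing into
  three regions, and the coordinates of the vertex are the numbers of triangles in these regions. They
  sum up to the number \<open>2 * 52 - 5 = 99\<close> of inner triangles. The wood is chosen invariant under the
  rotation that permutes the three copies of the gadget, so that this rotation becomes the cyclic shift
  \<open>turn\<close> of the coordinates. The list contains the coordinates of the inner vertices of copy \<open>0\<close>.
\<close>

definition gadget_coords :: "(int \<times> int \<times> int) list" where
  "gadget_coords = [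
     (34, 64, 1), (35, 34, 30), (36, 60, 3), (61, 36, 2), (57, 38, 4), (37, 57, 5), (38, 53, 8),
     (39, 35, 25), (41, 37, 21), (43, 39, 17), (53, 40, 6), (50, 42, 7), (47, 43, 9),
     (40, 49, 10), (42, 46, 11), (44, 41, 14)]"

definition turn :: "int \<times> int \<times> int \<Rightarrow> int \<times> int \<times> int" where
  "turn = (\<lambda>(a, b, c). (c, a, b))"

definition tetra_coords :: "(int \<times> int \<times> int) list" where
  "tetra_coords = [(33, 33, 33), (99, 0, 0), (0, 99, 0), (0, 0, 99)] @
     gadget_coords @ map turn gadget_coords @ map (turn \<circ> turn) gadget_coords"

fun exceeds :: "int \<times> int \<times> int \<Rightarrow> int \<times> int \<times> int \<Rightarrow> int \<times> int \<times> int \<Rightarrow> bool" where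
  "exceeds (a, b, c) (d, e, f) (x, y, z) \<longleftrightarrow>
     a < x \<and> d < x \<or> b < y \<and> e < y \<or> c < z \<and> f < z"

lemma tetra_coords_wf:
  "length tetra_coords = 52" "distinct tetra_coords"
  "list_all (\<lambda>(a, b, c). a + b + c = 99) tetra_coords"
  by code_simp+

lemma tetra_coords_dominated:
  "list_all (\<lambda>(U, V). list_all (\<lambda>W. W = U \<or> W = V \<or> exceeds U V W) tetra_coords)
     (map (\<lambda>(u, v). (tetra_coords ! u, tetra_coords ! v)) tetra_edges)"
  by code_simp

lemma place_inj: "list_all (\<lambda>i. distinct (map (place i) [0..<19])) [0, 1, 2]"
  by code_simp

text \<open>
  Eight inner vertices of the gadget, sorted such that each has at most one neighbour among the later
  ones and vertex \<open>0\<close>. The three copies of this forest meet in the centre.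
\<close>

definition gadget_forest :: "nat list" where
  "gadget_forest = [13, 15, 9, 10, 11, 7, 5, 3]"

definition tetra_forest :: "nat list" where
  "tetra_forest = concat (map (\<lambda>i. map (place i) gadget_forest) [0, 1, 2]) @ [0]"

text \<open>
  Only the few edges between forest vertices are relevant, and filtering them once keeps the
  computation short.
\<close>

lemma tetra_forest_order:
  "let es = filter (\<lambda>(u, v). u \<in> set tetra_forest \<and> v \<in> set tetra_forest) tetra_edges
   in leaf_order (\<lambda>v w. (v, w) \<in> set es \<or> (w, v) \<in> set es) tetra_forest"
  by code_simp

lemma tetra_forest_wf: "distinct tetra_forest" "length tetra_forest = 25" "list_all (\<lambda>v. v < 52) tetra_forest"
  by code_simp+

lemma planar_tetra_graph: "planar_graph tetra_graph"
proof -
  define x :: "nat \<Rightarrow> nat \<Rightarrow> real" where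
    "x k v = (case tetra_coords ! v of (a, b, c) \<Rightarrow> of_int (if k = 0 then a else if k = 1 then b else c))"
    for k v
  have sum: "x 0 v + x 1 v + x 2 v = 99" if "v < 52" for v
  proof -
    obtain a b c where v: "tetra_coords ! v = (a, b, c)"
      by (cases "tetra_coords ! v") auto
    have "tetra_coords ! v \<in> set tetra_coords"
      using that tetra_coords_wf(1) by simp
    then have "a + b + c = 99"
      using tetra_coords_wf(3) v by (auto simp: list_all_iff)
    then have "real_of_int (a + b + c) = 99"
      by simp
    then show ?thesis
      by (simp add: x_def v)
  qed
  have eq_coords: "v = w" if "v < 52" "w < 52" "tetra_coords ! v = tetra_coords ! w" for v w
    using nth_eq_iff_index_eq[OF tetra_coords_wf(2), of v w] that tetra_coords_wf(1) by simp
  have dom: "\<exists>k<3. x k u < x k w \<and> x k v < x k w"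
    if uv: "(u, v) \<in> set tetra_edges" and w: "w < 52" "w \<noteq> u" "w \<noteq> v" for u v w
  proof -
    have uv52: "u < 52" "v < 52"
      using uv tetra_edges_wf by (auto simp: list_all_iff)
    have "tetra_coords ! w \<in> set tetra_coords"
      using w(1) tetra_coords_wf(1) by simp
    moreover have "(tetra_coords ! u, tetra_coords ! v) \<in>
        set (map (\<lambda>(u, v). (tetra_coords ! u, tetra_coords ! v)) tetra_edges)"
      using uv by force
    ultimately have "tetra_coords ! w = tetra_coords ! u \<or> tetra_coords ! w = tetra_coords ! v \<or>
        exceeds (tetra_coords ! u) (tetra_coords ! v) (tetra_coords ! w)"
      using tetra_coords_dominated unfolding list_all_iff by blast
    then have "exceeds (tetra_coords ! u) (tetra_coords ! v) (tetra_coords ! w)"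
      using eq_coords w uv52 by blast
    moreover obtain a b c where U: "tetra_coords ! u = (a, b, c)"
      by (cases "tetra_coords ! u") auto
    moreover obtain d e f where V: "tetra_coords ! v = (d, e, f)"
      by (cases "tetra_coords ! v") auto
    moreover obtain p q r where W: "tetra_coords ! w = (p, q, r)"
      by (cases "tetra_coords ! w") auto
    ultimately consider "x 0 u < x 0 w \<and> x 0 v < x 0 w" | "x 1 u < x 1 w \<and> x 1 v < x 1 w"
      | "x 2 u < x 2 w \<and> x 2 v < x 2 w"
      by (auto simp: x_def)
    then show ?thesis
      by cases (rule exI[of _ 0], simp, rule exI[of _ 1], simp, rule exI[of _ 2], simp)
  qed
  interpret barycentric tetra_graph x 99
  proof (rule barycentric.intro)
    show "x 0 v + x 1 v + x 2 v = 99" if "v \<in> pverts tetra_graph" for v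
      using sum that by simp
    show "inj_on (\<lambda>v. (x 0 v, x 1 v)) (pverts tetra_graph)"
    proof (rule inj_onI)
      fix v w assume v: "v \<in> pverts tetra_graph" and w: "w \<in> pverts tetra_graph"
        and eq: "(x 0 v, x 1 v) = (x 0 w, x 1 w)"
      then have "x 2 v = x 2 w"
        using sum[of v] sum[of w] by simp
      with eq have "tetra_coords ! v = tetra_coords ! w"
        by (auto simp: x_def split: prod.splits)
      then show "v = w"
        using eq_coords v w by simp
    qed
    show "\<exists>k<3. x k u < x k w \<and> x k v < x k w"
      if "(u, v) \<in> parcs tetra_graph" "w \<in> pverts tetra_graph" "w \<noteq> u" "w \<noteq> v" for u v w
    proof (cases "(u, v) \<in> set tetra_edges")
      case True
      then show ?thesis using dom that by simp
    next
      case False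
      then have "(v, u) \<in> set tetra_edges"
        using that(1) by (simp add: parcs_tetra_graph)
      then show ?thesis using dom[of v u w] that by auto
    qed
  qed (rule pair_graph_tetra_graph)
  have "(0::nat) \<in> pverts tetra_graph"
    by simp
  then show ?thesis
    unfolding planar_graph_def using plane_drawing_straight pair_graph_tetra_graph by blast
qed

lemma place_gadget_cycle:
  assumes i: "i < 3" and c: "c \<in> set gadget_cycles"
  shows "distinct (map (place i) c)" "3 \<le> length (map (place i) c)"
    "\<forall>e \<in> set (zip (map (place i) c) (rotate1 (map (place i) c))). e \<in> parcs tetra_graph"
proof -
  have c: "3 \<le> length c" "distinct c" "set c \<subseteq> {..<19}"
    "\<forall>(u, v) \<in> set (zip c (rotate1 c)). (u, v) \<in> set gadget_edges \<or> (v, u) \<in> set gadget_edges"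
    using cycle_in_gadget_cycles gadget_cycles_bounded c by (auto simp: list_all_iff cycle_in_def)
  have "i \<in> set [0, 1, 2]"
    using i by auto
  then have "distinct (map (place i) [0..<19])"
    using place_inj by (auto simp: list_all_iff)
  then have "inj_on (place i) {..<19}"
    by (simp add: distinct_map atLeast_upt)
  then show "distinct (map (place i) c)" "3 \<le> length (map (place i) c)"
    using c by (auto simp: distinct_map intro: inj_on_subset)
  show "\<forall>e \<in> set (zip (map (place i) c) (rotate1 (map (place i) c))). e \<in> parcs tetra_graph"
  proof
    fix e assume "e \<in> set (zip (map (place i) c) (rotate1 (map (place i) c)))"
    then obtain u v where uv: "(u, v) \<in> set (zip c (rotate1 c))" "e = (place i u, place i v)"
      by (auto simp: rotate1_map zip_map_map)
    have "(u, v) \<in> set gadget_edges \<or> (v, u) \<in> set gadget_edges"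
      using c(4) uv(1) by blast
    moreover have "(place i p, place i q) \<in> set tetra_edges" if "(p, q) \<in> set gadget_edges" for p q
    proof -
      have "(place i p, place i q) \<in> set (map (\<lambda>(u, v). (place i u, place i v)) gadget_edges)"
        unfolding set_map by (rule image_eqI[OF _ that]) simp
      then show ?thesis
        unfolding tetra_edges_def set_concat set_map using \<open>i \<in> set [0, 1, 2]\<close>
        by (intro UnionI[of "set (map (\<lambda>(u, v). (place i u, place i v)) gadget_edges)"] imageI) simp_all
    qed
    ultimately show "e \<in> parcs tetra_graph"
      unfolding uv(2) parcs_tetra_graph by blast
  qed
qed

text \<open>
  A copy whose vertex \<open>2\<close> is in the forest, together with \<open>0\<close> or \<open>1\<close>, loses one inner vertex. Whatever
  tetrahedron vertices the forest contains, the losses compensate for all but one of them.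
\<close>

lemma card_forest_tetra_graph_le:
  assumes F: "F \<subseteq> {..<52}" and forest: "undirected_forest (with_proj tetra_graph \<restriction> F)"
  shows "card F \<le> 25"
proof -
  define X where "X i = {j. j < 19 \<and> place i j \<in> F}" for i
  have bound: "card (X i \<inter> {3..<19}) + (if 2 \<in> X i \<and> (0 \<in> X i \<or> 1 \<in> X i) then 1 else 0) \<le> 8"
    if i: "i < 3" for i
  proof (rule gadget_bound, intro ballI notI)
    fix c assume c: "c \<in> set gadget_cycles" "set c \<subseteq> X i"
    then have "set (map (place i) c) \<subseteq> F"
      by (auto simp: X_def)
    with not_forest_if_cyclic_list[OF place_gadget_cycle(1,2)[OF i c(1)] this] F forest
      place_gadget_cycle(3)[OF i c(1)] show False
      by simp
  qed
  define S where "S = F \<inter> {0, 1, 2, 3}"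
  have "F \<subseteq> S \<union> (place 0 ` (X 0 \<inter> {3..<19}) \<union> place 1 ` (X 1 \<inter> {3..<19}) \<union> place 2 ` (X 2 \<inter> {3..<19}))"
  proof
    fix v assume v: "v \<in> F"
    then have "v < 52" using F by auto
    show "v \<in> S \<union> (place 0 ` (X 0 \<inter> {3..<19}) \<union> place 1 ` (X 1 \<inter> {3..<19}) \<union> place 2 ` (X 2 \<inter> {3..<19}))"
    proof (cases "v < 4")
      case True
      then show ?thesis using v by (auto simp: S_def)
    next
      case False
      \<comment> \<open>The numbers \<open>4, ..., 51\<close> are three blocks of \<open>16\<close> inner vertices, which are the
        vertices \<open>3, ..., 18\<close> of the gadget.\<close>
      define i j where "i = (v - 4) div 16" and "j = (v - 4) mod 16 + 3"
      have ij: "i < 3" "j \<in> {3..<19}" "v = place i j"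
        using False \<open>v < 52\<close> by (auto simp: i_def j_def place_def)
      then have "v \<in> place i ` (X i \<inter> {3..<19})"
        using v by (auto simp: X_def)
      moreover have "i = 0 \<or> i = 1 \<or> i = 2"
        using ij(1) by auto
      ultimately show ?thesis by auto
    qed
  qed
  then have "card F \<le> card (S \<union> (place 0 ` (X 0 \<inter> {3..<19}) \<union> place 1 ` (X 1 \<inter> {3..<19}) \<union> place 2 ` (X 2 \<inter> {3..<19})))"
    by (intro card_mono) (auto simp: S_def)
  also have "\<dots> \<le> card S + (card (X 0 \<inter> {3..<19}) + card (X 1 \<inter> {3..<19}) + card (X 2 \<inter> {3..<19}))"
    by (intro order_trans[OF card_Un_le] add_mono order_refl card_image_le) auto
  finally have total: "card F \<le> card S + (card (X 0 \<inter> {3..<19}) + card (X 1 \<inter> {3..<19}) + card (X 2 \<inter> {3..<19}))" .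
  have "place 0 0 = 0" "place 0 1 = 2" "place 0 2 = 1" "place 1 0 = 0" "place 1 1 = 3" "place 1 2 = 2"
    "place 2 0 = 0" "place 2 1 = 1" "place 2 2 = 3"
    by code_simp+
  note corners = this
  have corner:
    "0 \<in> X 0 \<longleftrightarrow> 0 \<in> F" "1 \<in> X 0 \<longleftrightarrow> 2 \<in> F" "2 \<in> X 0 \<longleftrightarrow> 1 \<in> F"
    "0 \<in> X 1 \<longleftrightarrow> 0 \<in> F" "1 \<in> X 1 \<longleftrightarrow> 3 \<in> F" "2 \<in> X 1 \<longleftrightarrow> 2 \<in> F"
    "0 \<in> X 2 \<longleftrightarrow> 0 \<in> F" "1 \<in> X 2 \<longleftrightarrow> 1 \<in> F" "2 \<in> X 2 \<longleftrightarrow> 3 \<in> F"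
    unfolding X_def mem_Collect_eq corners by simp_all
  have "card (X 0 \<inter> {3..<19}) + (if 1 \<in> F \<and> (0 \<in> F \<or> 2 \<in> F) then 1 else 0) \<le> 8"
    "card (X 1 \<inter> {3..<19}) + (if 2 \<in> F \<and> (0 \<in> F \<or> 3 \<in> F) then 1 else 0) \<le> 8"
    "card (X 2 \<inter> {3..<19}) + (if 3 \<in> F \<and> (0 \<in> F \<or> 1 \<in> F) then 1 else 0) \<le> 8"
    using bound[of 0] bound[of 1] bound[of 2] unfolding corner by simp_all
  moreover have "card S = of_bool (0 \<in> F) + of_bool (1 \<in> F) + of_bool (2 \<in> F) + of_bool (3 \<in> F)"
    unfolding S_def by (simp add: Int_insert_right)
  ultimately show ?thesis
    using total by (cases "0 \<in> F"; cases "1 \<in> F"; cases "2 \<in> F"; cases "3 \<in> F") simp_all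
qed

lemma forest_number_tetra_graph: "forest_number tetra_graph = 25"
  unfolding forest_number_def
proof (rule Max_eqI)
  let ?sizes = "{card F | F. F \<subseteq> pverts tetra_graph \<and> undirected_forest (with_proj tetra_graph \<restriction> F)}"
  have "?sizes \<subseteq> card ` Pow {..<52::nat}"
    by auto
  then show "finite ?sizes"
    by (rule finite_subset) simp
  show "n \<le> 25" if "n \<in> ?sizes" for n
    using that card_forest_tetra_graph_le by auto
  have "sym (parcs tetra_graph)" "irrefl (parcs tetra_graph)"
    using tetra_edges_wf by (auto simp: sym_def irrefl_def parcs_tetra_graph list_all_iff)
  moreover have "leaf_order (\<lambda>v w. (v, w) \<in> parcs tetra_graph) tetra_forest"
    using tetra_forest_order unfolding Let_def
    by (rule leaf_order_cong) (auto simp: parcs_tetra_graph)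
  ultimately have "undirected_forest (with_proj tetra_graph \<restriction> set tetra_forest)"
    by (intro forest_if_leaf_order)
  moreover have "set tetra_forest \<subseteq> pverts tetra_graph" "card (set tetra_forest) = 25"
    using tetra_forest_wf by (auto simp: list_all_iff distinct_card)
  ultimately show "25 \<in> ?sizes"
    unfolding mem_Collect_eq by (intro exI[of _ "set tetra_forest"]) simp
qed

section \<open>A planar graph on 52 vertices without a forest on 26 vertices\<close>

theorem theorem4p1:
  shows "(\<exists>G52 :: nat pair_pre_digraph.
            planar_graph G52 \<and> card (pverts G52) = 52 \<and> forest_number G52 = 25)
         \<and> c_planar \<le> 25 / 52"
proof -
  have graph: "planar_graph tetra_graph \<and> card (pverts tetra_graph) = 52 \<and> forest_number tetra_graph = 25"
    using planar_tetra_graph forest_number_tetra_graph by simp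
  have "c_planar \<le> real (forest_number tetra_graph) / real (card (pverts tetra_graph))"
    unfolding c_planar_def
  proof (rule cInf_lower)
    show "bdd_below {real (forest_number G) / real (card (pverts G)) | G :: nat pair_pre_digraph.
        planar_graph G}"
      by (rule bdd_belowI[of _ 0]) auto
  qed (use graph in blast)
  with graph show ?thesis
    by auto
qed

end
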